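(* Let $M$ be a real Hilbert space, let $G$ be a finite group acting isometrically on $M$, let $Y_1,\dots,Y_I\in M$ be a sample, and let $m_0\in M$ be a starting point. Then the max-max algorithm started from $m_0$ reaches convergence in a finite number of steps; that is, for the sequence $(m_n)_{n\ge 0}$ it produces, there exists $n$ such that $m_{n+1}=m_n$.
   Context: The action of $G$ on $M$ is isometric if for each $g\in G$ the map $x\mapsto g\cdot x$ is linear and preserves the norm. For $x\in M$ and $\underline g=(g_1,\dots,g_I)\in G^I$ define $$J(x,\underline g)=\frac1I\sum_{i=1}^I\|x-g_i\cdot Y_i\|^2 .$$ Max-max algorithm: starting from $m_0\in M$, for $n=0,1,2,\dots$: (1) choose $\underline g^n=(g_1^n,\dots,g_I^n)\in G^I$ minimizing $\underline g\mapsto J(m_n,\underline g)$ (i.e. for each $i$, $g_i^n$ minimizes $g\mapsto\|m_n-g\cdot Y_i\|$ over $G$; one says that $Y_i$ is registered with respect to $m_n$); (2) let $m_{n+1}=\frac1I\sum_{i=1}^I g_i^n\cdot Y_i$, which is the unique minimizer of $x\mapsto J(x,\underline g^n)$ over $M$. The algorithm is stopped (convergence is reached) as soon as $m_{n+1}=m_n$. *)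

theory Defs
  imports "HOL-Analysis.Inner_Product" "HOL-Algebra.Group_Action"
begin

text \<open>
  The ambient Hilbert space \<open>M\<close> is a type of class \<open>{real_inner, complete_space}\<close>.
  An action is a homomorphism \<open>act\<close> from \<open>G\<close> to the group of bijections of \<open>M\<close>, so that
  \<open>act g x\<close> is \<open>g \<cdot> x\<close>.
\<close>

locale isometric_action = group_action G UNIV act
  for G (structure) and act :: "'g \<Rightarrow> 'a::{real_inner, complete_space} \<Rightarrow> 'a" +
  assumes act_linear: "g \<in> carrier G \<Longrightarrow> linear (act g)"
    and act_norm: "g \<in> carrier G \<Longrightarrow> norm (act g x) = norm x"

text \<open>
  The sample is \<open>Y 1, \<dots>, Y I\<close>, and values of \<open>Y\<close> outside \<open>{1..I}\<close> are irrelevant.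
\<close>

definition J ::
  "('g \<Rightarrow> 'a::{real_inner, complete_space} \<Rightarrow> 'a) \<Rightarrow> nat \<Rightarrow> (nat \<Rightarrow> 'a) \<Rightarrow> 'a \<Rightarrow> (nat \<Rightarrow> 'g) \<Rightarrow> real"
  where "J act I Y x g = (1 / real I) * (\<Sum>i=1..I. (norm (x - act (g i) (Y i)))\<^sup>2)"

text \<open>
  Minimizers in the registration step need not be unique, so the algorithm is a relation:
  \<open>m\<close> and \<open>g\<close> are the iterates and the registrations of one of its possible runs. A run is
  continued past convergence; the stopping criterion is a property of the sequence \<open>m\<close>.
\<close>

definition max_max_run ::
  "('g, 'b) monoid_scheme \<Rightarrow> ('g \<Rightarrow> 'a::{real_inner, complete_space} \<Rightarrow> 'a) \<Rightarrow> nat \<Rightarrow> (nat \<Rightarrow> 'a)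
    \<Rightarrow> 'a \<Rightarrow> (nat \<Rightarrow> 'a) \<Rightarrow> (nat \<Rightarrow> nat \<Rightarrow> 'g) \<Rightarrow> bool"
  where "max_max_run G act I Y m0 m g \<longleftrightarrow>
    m 0 = m0 \<and>
    (\<forall>n. is_arg_min (J act I Y (m n)) (\<lambda>h. h \<in> {1..I} \<rightarrow>\<^sub>E carrier G) (g n) \<and>
         m (Suc n) = (1 / real I) *\<^sub>R (\<Sum>i=1..I. act (g n i) (Y i)))"

end

theory Submission
  imports Defs
begin

text \<open>
  The registrations \<open>g n\<close> range over the finite set \<open>G\<^sup>I\<close>, so it suffices to show that a run
  without a stationary step never repeats a registration. Consider the energy left after
  averaging, \<open>J (m (Suc n)) (g n)\<close>. It depends on \<open>g n\<close> alone, because \<open>m (Suc n)\<close> is the mean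
  of the registered sample. Registering afresh with respect to \<open>m (Suc n)\<close> does not increase
  it, and the averaging that follows lowers it by exactly
  \<open>\<parallel>m (Suc n) - m (Suc (Suc n))\<parallel>\<^sup>2\<close> (lemma \<open>J_eq_J_mean_add\<close>). So as long as the iterates keep
  moving, this energy decreases strictly, and distinct energies come from distinct
  registrations.
\<close>

definition registered_mean ::
  "('g \<Rightarrow> 'a::{real_inner, complete_space} \<Rightarrow> 'a) \<Rightarrow> nat \<Rightarrow> (nat \<Rightarrow> 'a) \<Rightarrow> (nat \<Rightarrow> 'g) \<Rightarrow> 'a"
  where "registered_mean act I Y g = (1 / real I) *\<^sub>R (\<Sum>i=1..I. act (g i) (Y i))"

text \<open>
  The Huygens--Steiner identity: expanding the squares around \<open>c\<close>, the cross terms add up to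
  the inner product of \<open>x - c\<close> with \<open>\<Sum>i\<in>A. (c - z i)\<close>, which vanishes.
\<close>

lemma sum_norm_diff_sq_eq_about_mean:
  fixes z :: "'i \<Rightarrow> 'a::real_inner"
  assumes mean: "real (card A) *\<^sub>R c = (\<Sum>i\<in>A. z i)"
  shows "(\<Sum>i\<in>A. (norm (x - z i))\<^sup>2)
    = (\<Sum>i\<in>A. (norm (c - z i))\<^sup>2) + real (card A) * (norm (x - c))\<^sup>2"
proof -
  have expand: "(norm (x - z i))\<^sup>2
      = (norm (c - z i))\<^sup>2 + (norm (x - c))\<^sup>2 + 2 * inner (x - c) (c - z i)" for i
    by (simp add: power2_norm_eq_inner inner_diff_left inner_diff_right inner_commute)
  have "(\<Sum>i\<in>A. inner (x - c) (c - z i)) = inner (x - c) (\<Sum>i\<in>A. c - z i)"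
    by (simp add: inner_sum_right)
  also have "\<dots> = 0"
    by (simp add: sum_subtractf mean[symmetric] sum_constant_scaleR)
  finally have "(\<Sum>i\<in>A. inner (x - c) (c - z i)) = 0" .
  then show ?thesis
    by (simp add: expand sum.distrib sum_distrib_left[symmetric])
qed

lemma J_eq_J_mean_add:
  assumes "I \<ge> 1"
  shows "J act I Y x g
    = J act I Y (registered_mean act I Y g) g + (norm (x - registered_mean act I Y g))\<^sup>2"
proof -
  have "real (card {1..I}) *\<^sub>R registered_mean act I Y g = (\<Sum>i=1..I. act (g i) (Y i))"
    using assms by (simp add: registered_mean_def)
  from sum_norm_diff_sq_eq_about_mean[OF this, of x] show ?thesis
    using assms by (simp add: J_def field_simps)
qed

theorem proposition2p7:
  fixes G :: "('g, 'b) monoid_scheme"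
    and act :: "'g \<Rightarrow> 'a::{real_inner, complete_space} \<Rightarrow> 'a"
    and I :: nat
    and Y :: "nat \<Rightarrow> 'a"
    and m0 :: 'a
    and m :: "nat \<Rightarrow> 'a"
    and g :: "nat \<Rightarrow> nat \<Rightarrow> 'g"
  assumes "isometric_action G act"
    and "finite (carrier G)"
    and "I \<ge> 1"
    and "max_max_run G act I Y m0 m g"
  shows "\<exists>n. m (Suc n) = m n"
proof (rule ccontr)
  assume "\<not> (\<exists>n. m (Suc n) = m n)"
  then have moving: "m (Suc n) \<noteq> m n" for n by blast
  let ?R = "{1..I} \<rightarrow>\<^sub>E carrier G"
  have registered: "is_arg_min (J act I Y (m n)) (\<lambda>h. h \<in> ?R) (g n)"
    and mean: "m (Suc n) = registered_mean act I Y (g n)" for n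
    using assms(4) by (auto simp: max_max_run_def registered_mean_def)
  have in_R: "g n \<in> ?R" for n
    using registered[of n] by (simp add: is_arg_min_def)
  have minimal: "J act I Y (m n) (g n) \<le> J act I Y (m n) h" if "h \<in> ?R" for n h
    using registered[of n] that by (auto simp: is_arg_min_linorder)

  define energy where "energy h = J act I Y (registered_mean act I Y h) h" for h
  have decrease: "energy (g (Suc n)) < energy (g n)" for n
  proof -
    have "energy (g (Suc n)) < J act I Y (m (Suc n)) (g (Suc n))"
      using J_eq_J_mean_add[OF assms(3), of act Y "m (Suc n)" "g (Suc n)"] moving[of "Suc n"]
      by (simp add: energy_def mean[of "Suc n"])
    also have "\<dots> \<le> J act I Y (m (Suc n)) (g n)"
      by (rule minimal[OF in_R])
    also have "\<dots> = energy (g n)"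
      by (simp add: energy_def mean)
    finally show ?thesis .
  qed
  have "energy (g k) < energy (g n)" if "n < k" for n k
    using lift_Suc_mono_less[of "\<lambda>n. - energy (g n)" n k] decrease that by simp
  then have "inj g"
    by (intro linorder_injI) force
  moreover have "finite (range g)"
    by (rule finite_subset[of _ ?R]) (use in_R assms(2) in \<open>auto intro: finite_PiE\<close>)
  ultimately show False
    using finite_imageD by blast
qed

end
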